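(* Let $\mathbb G$ be a Carnot group and let $W\subseteq\mathrm{Lie}(\mathbb G)$ be a nonempty subset with $\mathbb R_+W=W$. A set $E\subseteq\mathbb G$ has the $S_W$-cone property if and only if $E$ is precisely $X$-monotone for all $X\in W$. In particular: (a) the set $S_W$ is precisely $X$-monotone for all $X\in W$; (b) if $A$ is an arbitrary set and $(E_\alpha)_{\alpha\in A}$ is a family of subsets of $\mathbb G$ each of which is precisely $X$-monotone for all $X\in W$, then $E:=\bigcup_{\alpha\in A}E_\alpha$ is precisely $X$-monotone for all $X\in W$; (c) every set $E\subseteq\mathbb G$ that is precisely $X$-monotone for all $X\in W$ satisfies $$E=\bigcup_{p\in E}p\,S_W,$$ if either $E$ is open or $1_{\mathbb G}\in S_W$.
   Context: $\mathbb R_+=(0,+\infty)$ (so $0$ need not belong to $W$). Elements of $\mathrm{Lie}(\mathbb G)$ are regarded as left-invariant vector fields, and $1_{\mathbb G}$ is the identity. $S_W$ denotes the semigroup generated by $\exp(W)$: $S_W=\bigcup_{k\ge1}\{\exp(w_1)\cdots\exp(w_k): w_1,\dots,w_k\in W\}$. A set $E\subseteq \mathbb G$ has the $S_W$-cone property if $E\cdot S_W\subseteq E$. A set $E\subseteq\mathbb G$ is precisely $X$-monotone if $E\exp(tX)\subseteq E$ for all $t>0$ (here for arbitrary subsets $E$, measurable or not). *)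

theory Defs
  imports "HOL-Analysis.Analysis" "HOL-Algebra.Coset" "HOL-Library.Function_Algebras"
begin

instantiation "fun" :: (type, real_vector) real_vector
begin

definition scaleR_fun :: "real \<Rightarrow> ('a \<Rightarrow> 'b) \<Rightarrow> 'a \<Rightarrow> 'b" where
  "scaleR_fun r f = (\<lambda>x. r *\<^sub>R f x)"

instance
  by standard (simp_all add: scaleR_fun_def plus_fun_def scaleR_add_right scaleR_add_left)

end


section \<open>Smooth manifolds\<close>

text \<open>\<open>Ck k f S\<close> is meant for open \<open>S\<close>: \<open>f\<close> is \<open>k\<close> times continuously differentiable on \<open>S\<close>.\<close>

primrec Ck :: "nat \<Rightarrow> ('a::euclidean_space \<Rightarrow> 'b::euclidean_space) \<Rightarrow> 'a set \<Rightarrow> bool" where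
  "Ck 0 f S \<longleftrightarrow> continuous_on S f"
| "Ck (Suc k) f S \<longleftrightarrow>
     (\<forall>x\<in>S. f differentiable (at x)) \<and> (\<forall>v. Ck k (\<lambda>x. frechet_derivative f (at x) v) S)"

definition smooth_on :: "'a::euclidean_space set \<Rightarrow> ('a \<Rightarrow> 'b::euclidean_space) \<Rightarrow> bool" where
  "smooth_on S f \<longleftrightarrow> (\<forall>k. Ck k f S)"

text \<open>A chart is a pair \<open>(U, \<phi>)\<close>; only the values of \<open>\<phi>\<close> on \<open>U\<close> matter, and the inverse chart is
  \<open>inv_into U \<phi>\<close>. The atlas need not be maximal.\<close>

locale smooth_manifold =
  fixes atlas :: "('g::{t2_space,second_countable_topology} set \<times> ('g \<Rightarrow> 'e::euclidean_space)) set"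
  assumes chart: "(U, \<phi>) \<in> atlas \<Longrightarrow>
      open U \<and> open (\<phi> ` U) \<and> homeomorphism U (\<phi> ` U) \<phi> (inv_into U \<phi>)"
    and charts_cover: "\<Union> (fst ` atlas) = UNIV"
    and charts_compatible: "(U, \<phi>) \<in> atlas \<Longrightarrow> (V, \<psi>) \<in> atlas \<Longrightarrow>
      smooth_on (\<phi> ` (U \<inter> V)) (\<psi> \<circ> inv_into U \<phi>)"

definition smooth_fun_on ::
    "('g::{t2_space,second_countable_topology} set \<times> ('g \<Rightarrow> 'e::euclidean_space)) set
      \<Rightarrow> 'g set \<Rightarrow> ('g \<Rightarrow> real) \<Rightarrow> bool" where
  "smooth_fun_on atlas S f \<longleftrightarrow>
     (\<forall>(U, \<phi>) \<in> atlas. smooth_on (\<phi> ` (U \<inter> S)) (f \<circ> inv_into U \<phi>))"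

definition smooth_near ::
    "('g::{t2_space,second_countable_topology} set \<times> ('g \<Rightarrow> 'e::euclidean_space)) set
      \<Rightarrow> 'g \<Rightarrow> ('g \<Rightarrow> real) \<Rightarrow> bool" where
  "smooth_near atlas p f \<longleftrightarrow> (\<exists>S. open S \<and> p \<in> S \<and> smooth_fun_on atlas S f)"

definition smooth_curve_on ::
    "('g::{t2_space,second_countable_topology} set \<times> ('g \<Rightarrow> 'e::euclidean_space)) set
      \<Rightarrow> real set \<Rightarrow> (real \<Rightarrow> 'g) \<Rightarrow> bool" where
  "smooth_curve_on atlas I \<gamma> \<longleftrightarrow>
     continuous_on I \<gamma> \<and> (\<forall>(U, \<phi>) \<in> atlas. smooth_on (I \<inter> \<gamma> -` U) (\<phi> \<circ> \<gamma>))"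


section \<open>Vector fields\<close>

text \<open>A tangent vector at \<open>p\<close> is the velocity \<open>f \<mapsto> (f \<circ> \<gamma>)'(0)\<close> of a smooth curve through \<open>p\<close>,
  acting on the functions that are smooth in a neighbourhood of \<open>p\<close>. The value \<open>0\<close> on all
  other functions is a convention; it makes tangent vectors at \<open>p\<close> equal as soon as they agree
  on the functions smooth near \<open>p\<close>.\<close>

definition velocity ::
    "('g::{t2_space,second_countable_topology} set \<times> ('g \<Rightarrow> 'e::euclidean_space)) set
      \<Rightarrow> (real \<Rightarrow> 'g) \<Rightarrow> ('g \<Rightarrow> real) \<Rightarrow> real" where
  "velocity atlas \<gamma> = (\<lambda>f. if smooth_near atlas (\<gamma> 0) f then deriv (f \<circ> \<gamma>) 0 else 0)"

definition tangent_space ::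
    "('g::{t2_space,second_countable_topology} set \<times> ('g \<Rightarrow> 'e::euclidean_space)) set
      \<Rightarrow> 'g \<Rightarrow> (('g \<Rightarrow> real) \<Rightarrow> real) set" where
  "tangent_space atlas p =
     {velocity atlas \<gamma> | \<gamma> \<epsilon>. 0 < \<epsilon> \<and> smooth_curve_on atlas {-\<epsilon><..<\<epsilon>} \<gamma> \<and> \<gamma> 0 = p}"

type_synonym 'g vfield = "'g \<Rightarrow> ('g \<Rightarrow> real) \<Rightarrow> real"

definition vector_field ::
    "('g::{t2_space,second_countable_topology} set \<times> ('g \<Rightarrow> 'e::euclidean_space)) set
      \<Rightarrow> 'g vfield \<Rightarrow> bool" where
  "vector_field atlas X \<longleftrightarrow>
     (\<forall>p. X p \<in> tangent_space atlas p) \<and>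
     (\<forall>S f. open S \<and> smooth_fun_on atlas S f \<longrightarrow> smooth_fun_on atlas S (\<lambda>q. X q f))"

text \<open>The case distinction keeps the convention for functions that are not smooth near \<open>p\<close>:
  for such \<open>f\<close> the function \<open>q \<mapsto> Y q f\<close> may nevertheless be smooth near \<open>p\<close>.\<close>

definition lie_bracket ::
    "('g::{t2_space,second_countable_topology} set \<times> ('g \<Rightarrow> 'e::euclidean_space)) set
      \<Rightarrow> 'g vfield \<Rightarrow> 'g vfield \<Rightarrow> 'g vfield" where
  "lie_bracket atlas X Y =
     (\<lambda>p f. if smooth_near atlas p f then X p (\<lambda>q. Y q f) - Y p (\<lambda>q. X q f) else 0)"

text \<open>\<open>\<gamma>'(t) = X (\<gamma> t)\<close> for all real \<open>t\<close>, tested against functions smooth near \<open>\<gamma> t\<close>.\<close>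

definition integral_curve ::
    "('g::{t2_space,second_countable_topology} set \<times> ('g \<Rightarrow> 'e::euclidean_space)) set
      \<Rightarrow> 'g vfield \<Rightarrow> (real \<Rightarrow> 'g) \<Rightarrow> bool" where
  "integral_curve atlas X \<gamma> \<longleftrightarrow>
     continuous_on UNIV \<gamma> \<and>
     (\<forall>t f. smooth_near atlas (\<gamma> t) f \<longrightarrow> (f \<circ> \<gamma> has_real_derivative X (\<gamma> t) f) (at t))"


section \<open>Lie groups\<close>

locale lie_group = smooth_manifold atlas + group G
  for atlas :: "('g::{t2_space,second_countable_topology} set \<times> ('g \<Rightarrow> 'e::euclidean_space)) set"
    and G :: "'g monoid" (structure) +
  assumes carrier_UNIV: "carrier G = UNIV"
    and continuous_mult: "continuous_on UNIV (\<lambda>(x, y). x \<otimes> y)"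
    and smooth_mult: "(U, \<phi>) \<in> atlas \<Longrightarrow> (V, \<psi>) \<in> atlas \<Longrightarrow> (Z, \<theta>) \<in> atlas \<Longrightarrow>
      smooth_on {(\<phi> x, \<psi> y) | x y. x \<in> U \<and> y \<in> V \<and> x \<otimes> y \<in> Z}
        (\<lambda>(a, b). \<theta> (inv_into U \<phi> a \<otimes> inv_into V \<psi> b))"
    and continuous_inv: "continuous_on UNIV (\<lambda>x. inv x)"
    and smooth_inv: "(U, \<phi>) \<in> atlas \<Longrightarrow> (V, \<psi>) \<in> atlas \<Longrightarrow>
      smooth_on {\<phi> x | x. x \<in> U \<and> inv x \<in> V} (\<lambda>a. \<psi> (inv (inv_into U \<phi> a)))"

definition left_invariant :: "'g monoid \<Rightarrow> 'g vfield \<Rightarrow> bool" where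
  "left_invariant G X \<longleftrightarrow> (\<forall>g p f. X (g \<otimes>\<^bsub>G\<^esub> p) f = X p (\<lambda>q. f (g \<otimes>\<^bsub>G\<^esub> q)))"

definition lie_algebra ::
    "('g::{t2_space,second_countable_topology} set \<times> ('g \<Rightarrow> 'e::euclidean_space)) set
      \<Rightarrow> 'g monoid \<Rightarrow> 'g vfield set" where
  "lie_algebra atlas G = {X. vector_field atlas X \<and> left_invariant G X}"

definition lie_exp ::
    "('g::{t2_space,second_countable_topology} set \<times> ('g \<Rightarrow> 'e::euclidean_space)) set
      \<Rightarrow> 'g monoid \<Rightarrow> 'g vfield \<Rightarrow> 'g" where
  "lie_exp atlas G X = (THE \<gamma>. integral_curve atlas X \<gamma> \<and> \<gamma> 0 = \<one>\<^bsub>G\<^esub>) 1"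


section \<open>Carnot groups\<close>

definition bracket_span ::
    "('g::{t2_space,second_countable_topology} set \<times> ('g \<Rightarrow> 'e::euclidean_space)) set
      \<Rightarrow> 'g vfield set \<Rightarrow> 'g vfield set \<Rightarrow> 'g vfield set" where
  "bracket_span atlas A B = span {lie_bracket atlas X Y | X Y. X \<in> A \<and> Y \<in> B}"

text \<open>The layers are \<open>V 1, \<dots>, V s\<close>; the values of \<open>V\<close> at other indices are irrelevant.\<close>

definition stratification ::
    "('g::{t2_space,second_countable_topology} set \<times> ('g \<Rightarrow> 'e::euclidean_space)) set
      \<Rightarrow> 'g monoid \<Rightarrow> (nat \<Rightarrow> 'g vfield set) \<Rightarrow> nat \<Rightarrow> bool" where
  "stratification atlas G V s \<longleftrightarrow>
     1 \<le> s \<and>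
     (\<forall>i\<in>{1..s}. subspace (V i) \<and> V i \<subseteq> lie_algebra atlas G) \<and>
     (\<forall>X\<in>lie_algebra atlas G. \<exists>!Y. Y \<in> (\<Pi>\<^sub>E i\<in>{1..s}. V i) \<and> X = (\<Sum>i\<in>{1..s}. Y i)) \<and>
     (\<forall>i\<in>{1..<s}. bracket_span atlas (V 1) (V i) = V (Suc i)) \<and>
     V s \<noteq> {0} \<and>
     bracket_span atlas (V 1) (V s) = {0}"

text \<open>\<open>simply_connected\<close> includes path-connectedness.\<close>

locale carnot_group = lie_group atlas G
  for atlas :: "('g::{t2_space,second_countable_topology} set \<times> ('g \<Rightarrow> 'e::euclidean_space)) set"
    and G :: "'g monoid" (structure) +
  fixes V :: "nat \<Rightarrow> 'g vfield set" and s :: nat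
  assumes simply_connected_group: "simply_connected (UNIV :: 'g set)"
    and stratified: "stratification atlas G V s"


section \<open>Semigroups, cone property and monotone sets\<close>

definition exp_semigroup ::
    "('g::{t2_space,second_countable_topology} set \<times> ('g \<Rightarrow> 'e::euclidean_space)) set
      \<Rightarrow> 'g monoid \<Rightarrow> 'g vfield set \<Rightarrow> 'g set" where
  "exp_semigroup atlas G W =
     {foldr (\<lambda>w x. lie_exp atlas G w \<otimes>\<^bsub>G\<^esub> x) ws \<one>\<^bsub>G\<^esub> | ws. ws \<noteq> [] \<and> set ws \<subseteq> W}"

definition cone_property :: "'g monoid \<Rightarrow> 'g set \<Rightarrow> 'g set \<Rightarrow> bool" where
  "cone_property G S E \<longleftrightarrow> E <#>\<^bsub>G\<^esub> S \<subseteq> E"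

definition precisely_monotone ::
    "('g::{t2_space,second_countable_topology} set \<times> ('g \<Rightarrow> 'e::euclidean_space)) set
      \<Rightarrow> 'g monoid \<Rightarrow> 'g vfield \<Rightarrow> 'g set \<Rightarrow> bool" where
  "precisely_monotone atlas G X E \<longleftrightarrow> (\<forall>t>0. E #>\<^bsub>G\<^esub> lie_exp atlas G (t *\<^sub>R X) \<subseteq> E)"

end

theory Submission
  imports Defs
begin

text \<open>
  Since \<open>W\<close> is invariant under positive dilations, being precisely \<open>X\<close>-monotone for all \<open>X \<in> W\<close>
  means being stable under right multiplication by \<open>exp w\<close> for \<open>w \<in> W\<close>, hence by words in such
  elements. The only analytic point is the open case of (c): there \<open>p \<cdot> exp(tX)\<^sup>-\<^sup>1 \<in> E\<close> for small
  \<open>t > 0\<close>, which needs \<open>exp(tX) \<rightarrow> 1\<close> and therefore the existence and uniqueness of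
  integral curves of left-invariant fields. Locally these come from the Picard-Lindeloef theorem in charts;
  left translation carries integral curves to integral curves and so makes them complete.
\<close>

section \<open>Ordinary differential equations\<close>

lemma picard_lindelof_global:
  fixes F :: "'e::euclidean_space \<Rightarrow> 'e"
  assumes lip: "L-lipschitz_on UNIV F"
  shows "\<exists>h>0. \<exists>x. x 0 = x0 \<and> continuous_on UNIV x \<and>
    (\<forall>t\<in>{-h<..<h}. (x has_vector_derivative F (x t)) (at t))"
proof -
  have L: "0 \<le> L" using lip lipschitz_on_nonneg by blast
  \<comment> \<open>The time span is chosen so that \<open>3 * h * L\<close>, which will be the
    contraction factor, is at most 3/4; \<open>L + 1\<close> keeps the denominator positive when
    \<open>L = 0\<close>.\<close>
  define h where "h = 1 / (4 * (L + 1))"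
  have h: "0 < h" and hL: "3 * h * L \<le> 3/4"
    using L by (auto simp: h_def divide_simps)
  have contF: "continuous_on UNIV F" using lip lipschitz_on_continuous_on by blast
  have cont: "continuous_on A (\<lambda>s. F (apply_bcontfun z s))" for z :: "real \<Rightarrow>\<^sub>C 'e" and A
    using continuous_on_compose2[OF contF, of A] by auto
  \<comment> \<open>The integral starts at \<open>-h\<close> instead of 0, so that one primitive
    serves both signs of \<open>t\<close>; subtracting \<open>I z 0\<close> in the Picard operator
    restores the initial value.\<close>
  define I where "I z t = integral {-h..t} (\<lambda>s. F (apply_bcontfun z s))" for z :: "real \<Rightarrow>\<^sub>C 'e" and t
  \<comment> \<open>Clamping the time makes the Picard operator act on bounded continuous functions on all of \<open>\<real>\<close>.\<close>
  define T where "T z = (\<lambda>t. x0 + I z (clamp (-h) h t) - I z 0)" for z :: "real \<Rightarrow>\<^sub>C 'e"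
  have clamp_in: "clamp (-h) h t \<in> {-h..h}" for t :: real
    using clamp_in_interval[of "-h" h t] h by (simp add: cbox_interval)
  have clamp_id: "clamp (-h) h t = t" if "t \<in> {-h..h}" for t :: real
    using clamp_cancel_cbox[of t "-h" h] that by (simp add: cbox_interval)
  have I_deriv: "(I z has_vector_derivative F (apply_bcontfun z t)) (at t within {-h..h})"
    if "t \<in> {-h..h}" for z t
    unfolding I_def by (rule integral_has_vector_derivative[OF cont that])
  have I_cont: "continuous_on {-h..h} (I z)" for z
    unfolding continuous_on_eq_continuous_within using I_deriv has_vector_derivative_continuous by blast
  have T_cont: "continuous_on UNIV (T z)" for z
    unfolding T_def using clamp_continuous_on[of "-h" h "I z"] I_cont[of z]
    by (intro continuous_intros) (auto simp: cbox_interval)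
  have T_bdd: "bounded (range (T z))" for z
  proof -
    have "bounded (I z ` {-h..h})"
      using I_cont compact_continuous_image compact_imp_bounded by blast
    then obtain B where B: "\<And>t. t \<in> {-h..h} \<Longrightarrow> norm (I z t) \<le> B"
      unfolding bounded_iff by blast
    have "norm (T z t) \<le> norm x0 + B + norm (I z 0)" for t
      unfolding T_def using B[OF clamp_in[of t]] norm_triangle_ineq4[of "x0 + I z (clamp (-h) h t)" "I z 0"]
        norm_triangle_ineq[of x0 "I z (clamp (-h) h t)"] by linarith
    then show ?thesis by (auto simp: bounded_iff)
  qed
  have T_app: "apply_bcontfun (Bcontfun (T z)) = T z" for z
    using T_cont T_bdd by (intro Bcontfun_inverse) (auto simp: bcontfun_def)
  have I_diff: "norm (I z t - I w t) \<le> L * dist z w * (t + h)" if "t \<in> {-h..h}" for z w t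
  proof -
    have "I z t - I w t = integral {-h..t} (\<lambda>s. F (apply_bcontfun z s) - F (apply_bcontfun w s))"
      unfolding I_def by (rule integral_diff[symmetric]) (intro integrable_continuous_real cont)+
    moreover have "norm (F (apply_bcontfun z s) - F (apply_bcontfun w s)) \<le> L * dist z w" for s
      using lipschitz_onD[OF lip, of "apply_bcontfun z s" "apply_bcontfun w s"]
        mult_left_mono[OF dist_bounded[of z s w] L] by (auto simp: dist_norm)
    ultimately show ?thesis
      using integral_bound[of "-h" t "\<lambda>s. F (apply_bcontfun z s) - F (apply_bcontfun w s)" "L * dist z w"] that
        continuous_on_diff[OF cont cont] by auto
  qed
  have "dist (Bcontfun (T z)) (Bcontfun (T w)) \<le> 3/4 * dist z w" for z w
  proof (rule dist_bound)
    fix t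
    define c where "c = clamp (-h) h t"
    have c: "c \<in> {-h..h}" unfolding c_def by (rule clamp_in)
    have "dist (T z t) (T w t) = norm ((I z c - I w c) - (I z 0 - I w 0))"
      by (simp add: T_def c_def dist_norm algebra_simps)
    \<comment> \<open>The clamped time contributes at most \<open>2 * h\<close> and the base-point
      correction contributes \<open>h\<close>, whence the factor \<open>3 * h\<close>.\<close>
    also have "\<dots> \<le> L * dist z w * (c + h) + L * dist z w * (0 + h)"
      using I_diff[OF c, of z w] I_diff[of 0 z w] h
        norm_triangle_ineq4[of "I z c - I w c" "I z 0 - I w 0"] by auto
    also have "\<dots> = L * dist z w * (c + 2 * h)" by (simp add: algebra_simps)
    also have "\<dots> \<le> L * dist z w * (3 * h)" using c L by (intro mult_left_mono) auto
    also have "\<dots> = 3 * h * L * dist z w" by simp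
    also have "\<dots> \<le> 3/4 * dist z w" using hL by (intro mult_right_mono) auto
    finally show "dist (apply_bcontfun (Bcontfun (T z)) t) (apply_bcontfun (Bcontfun (T w)) t) \<le> 3/4 * dist z w"
      by (simp add: T_app)
  qed
  then obtain z where z: "Bcontfun (T z) = z"
    using banach_fix_type[of "3/4" "\<lambda>z. Bcontfun (T z)"] by auto
  define x where "x = apply_bcontfun z"
  have xT: "x = T z" using T_app[of z] z by (simp add: x_def)
  have x0: "x 0 = x0" unfolding xT T_def using clamp_id[of 0] h by simp
  have der: "(x has_vector_derivative F (x t)) (at t)" if t: "t \<in> {-h<..<h}" for t
  proof -
    have "(I z has_vector_derivative F (x t)) (at t within {-h<..<h})"
      unfolding x_def using t
      by (intro has_vector_derivative_within_subset[OF I_deriv]) auto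
    then have "(I z has_vector_derivative F (x t)) (at t)"
      using t by (simp add: has_vector_derivative_def at_within_open[of t "{-h<..<h}"])
    then have "((\<lambda>t. x0 + I z t - I z 0) has_vector_derivative F (x t)) (at t)"
      by (auto intro!: derivative_eq_intros)
    then show ?thesis
      by (rule has_vector_derivative_transform_within_open[of _ _ _ "{-h<..<h}"])
        (use t in \<open>auto simp: xT T_def clamp_id\<close>)
  qed
  have "continuous_on UNIV x" unfolding xT by (rule T_cont)
  then show ?thesis using h x0 der by blast
qed

text \<open>Precomposing \<open>F\<close> with the nearest-point projection onto the closed ball
  gives a globally Lipschitz field, because the projection is 1-Lipschitz. By continuity the global
  solution stays in the ball for a short time, and there the projection is the identity.\<close>

lemma picard_lindelof:
  fixes F :: "'e::euclidean_space \<Rightarrow> 'e"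
  assumes r: "0 < r" and lip: "L-lipschitz_on (cball x0 r) F"
  shows "\<exists>h>0. \<exists>x. x 0 = x0 \<and>
    (\<forall>t\<in>{-h<..<h}. x t \<in> ball x0 r \<and> (x has_vector_derivative F (x t)) (at t))"
proof -
  define P where "P = closest_point (cball x0 r)"
  have P_in: "P y \<in> cball x0 r" for y
    unfolding P_def using r by (intro closest_point_in_set) auto
  have "dist (P y) (P z) \<le> dist y z" for y z
    unfolding P_def using r by (intro closest_point_lipschitz) auto
  then have "dist (F (P y)) (F (P z)) \<le> L * dist y z" for y z
    using lipschitz_onD[OF lip P_in P_in, of y z] lipschitz_on_nonneg[OF lip]
    by (meson mult_left_mono order_trans)
  then have "L-lipschitz_on UNIV (\<lambda>y. F (P y))"
    using lipschitz_on_nonneg[OF lip] by (auto intro: lipschitz_onI)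
  then obtain h x where h: "0 < h" and x: "x 0 = x0" "continuous_on UNIV x"
    and der: "\<And>t. t \<in> {-h<..<h} \<Longrightarrow> (x has_vector_derivative F (P (x t))) (at t)"
    using picard_lindelof_global[of L "\<lambda>y. F (P y)" x0] by auto
  have "open (x -` ball x0 r)" using x(2) by (simp add: continuous_on_open_vimage)
  moreover have "0 \<in> x -` ball x0 r" using x(1) r by simp
  ultimately obtain e where e: "0 < e" "ball 0 e \<subseteq> x -` ball x0 r"
    by (rule openE)
  have in_ball: "x t \<in> ball x0 r" if "\<bar>t\<bar> < e" for t
    using e(2) that by (auto simp: subset_iff dist_real_def)
  have "(x has_vector_derivative F (x t)) (at t)" if "\<bar>t\<bar> < h" "\<bar>t\<bar> < e" for t
  proof -
    have "P (x t) = x t"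
      unfolding P_def using in_ball[OF that(2)] by (intro closest_point_self) auto
    then show ?thesis using der[of t] that(1) by (auto simp: abs_less_iff)
  qed
  then show ?thesis using h e(1) in_ball x(1)
    by (intro exI[of _ "min h e"] conjI exI[of _ x]) auto
qed

text \<open>On an interval so short that \<open>L * d \<le> 1/2\<close>, the mean value inequality
  bounds the maximum of the distance between the two solutions by half of itself, so this maximum is
  zero.\<close>

lemma ode_unique_local:
  fixes F :: "'e::euclidean_space \<Rightarrow> 'e" and x y :: "real \<Rightarrow> 'e"
  assumes lip: "L-lipschitz_on K F" and e: "0 < e"
    and x: "\<And>t. t \<in> ball t0 e \<Longrightarrow> x t \<in> K \<and> (x has_vector_derivative F (x t)) (at t)"
    and y: "\<And>t. t \<in> ball t0 e \<Longrightarrow> y t \<in> K \<and> (y has_vector_derivative F (y t)) (at t)"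
    and eq: "x t0 = y t0"
  shows "\<exists>d>0. \<forall>t\<in>ball t0 d. x t = y t"
proof -
  have L: "0 \<le> L" using lip lipschitz_on_nonneg by blast
  \<comment> \<open>The first bound keeps the closed ball of radius \<open>d\<close> inside the
    domain, the second gives \<open>L * d \<le> 1/2\<close>.\<close>
  define d where "d = min (e/2) (1 / (2 * (L + 1)))"
  have d: "0 < d" "d < e" using e L by (auto simp: d_def)
  have "L * d \<le> L * (1 / (2 * (L + 1)))" using L by (intro mult_left_mono) (auto simp: d_def)
  also have "\<dots> \<le> 1/2" using L by (simp add: divide_simps)
  finally have dL: "L * d \<le> 1/2" .
  define z where "z t = x t - y t" for t
  have sub: "cball t0 d \<subseteq> ball t0 e" using d by auto
  have der: "(z has_vector_derivative F (x t) - F (y t)) (at t)" if "t \<in> cball t0 d" for t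
    unfolding z_def using x[of t] y[of t] that sub by (intro has_vector_derivative_diff) auto
  have "continuous_on (cball t0 d) (\<lambda>t. norm (z t))"
    using der has_vector_derivative_continuous[of z]
    by (intro continuous_on_norm continuous_at_imp_continuous_on) blast
  then obtain t1 where t1: "t1 \<in> cball t0 d" and mx: "\<And>t. t \<in> cball t0 d \<Longrightarrow> norm (z t) \<le> norm (z t1)"
    using continuous_attains_sup[of "cball t0 d" "\<lambda>t. norm (z t)"] d by auto
  have "norm (z t1 - z t0) \<le> (L * norm (z t1)) * norm (t1 - t0)"
  proof (rule differentiable_bound[of "cball t0 d" z "\<lambda>t u. u *\<^sub>R (F (x t) - F (y t))"])
    fix t assume t: "t \<in> cball t0 d"
    show "(z has_derivative (\<lambda>u. u *\<^sub>R (F (x t) - F (y t)))) (at t within cball t0 d)"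
      using der[OF t] by (auto simp: has_vector_derivative_def intro: has_derivative_at_withinI)
    have "norm (F (x t) - F (y t)) \<le> L * norm (z t)"
      using lipschitz_onD[OF lip, of "x t" "y t"] x[of t] y[of t] t sub by (auto simp: dist_norm z_def)
    also have "\<dots> \<le> L * norm (z t1)" using mx[OF t] L by (intro mult_left_mono)
    finally show "onorm (\<lambda>u. u *\<^sub>R (F (x t) - F (y t))) \<le> L * norm (z t1)"
      by (intro onorm_le) (simp add: mult.commute mult_left_mono)
  qed (use t1 d in auto)
  also have "\<dots> \<le> (L * norm (z t1)) * d"
    using t1 L by (intro mult_left_mono) (auto simp: dist_norm norm_minus_commute)
  also have "\<dots> = (L * d) * norm (z t1)" by simp
  also have "\<dots> \<le> 1/2 * norm (z t1)" using dL by (intro mult_right_mono) auto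
  finally have "norm (z t1) \<le> 1/2 * norm (z t1)" using eq by (simp add: z_def)
  then have "norm (z t1) \<le> 0" by simp
  then have "z t = 0" if "t \<in> ball t0 d" for t using mx[of t] that by auto
  then show ?thesis using d(1) by (auto simp: z_def)
qed

section \<open>Lipschitz bounds from differentiability, and closure properties of
  \<open>Ck\<close>\<close>

lemma Ck_1_lipschitz:
  fixes f :: "'a::euclidean_space \<Rightarrow> 'b::euclidean_space"
  assumes f: "Ck 1 f S" and K: "compact K" "convex K" "K \<subseteq> S"
  shows "\<exists>L. L-lipschitz_on K f"
proof -
  let ?D = "\<lambda>x. frechet_derivative f (at x)"
  have diff: "(f has_derivative ?D x) (at x)" if "x \<in> S" for x
    using f that by (simp add: frechet_derivative_works)
  have "\<exists>B. \<forall>x\<in>K. norm (?D x v) \<le> B" for v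
  proof -
    have "continuous_on K (\<lambda>x. ?D x v)"
      using f K(3) by (auto intro: continuous_on_subset)
    then have "bounded ((\<lambda>x. ?D x v) ` K)"
      using K(1) compact_continuous_image compact_imp_bounded by blast
    then show ?thesis by (auto simp: bounded_iff)
  qed
  then obtain B where B: "\<And>v x. x \<in> K \<Longrightarrow> norm (?D x v) \<le> B v" by metis
  \<comment> \<open>\<open>Ck\<close> controls the derivative one direction at a time. Compactness
    bounds it in each direction, and expanding a vector in the basis combines the finitely many
    bounds into an operator norm bound; convexity of \<open>K\<close> then allows the mean value
    inequality.\<close>
  define L where "L = (\<Sum>b\<in>Basis. \<bar>B b\<bar>)"
  have "norm (f x - f y) \<le> L * norm (x - y)" if "x \<in> K" "y \<in> K" for x y
  proof (rule differentiable_bound[OF K(2), of f ?D])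
    fix x assume x: "x \<in> K"
    then show "(f has_derivative ?D x) (at x within K)"
      using diff K(3) by (auto intro: has_derivative_at_withinI)
    have lin: "linear (?D x)" using diff x K(3) has_derivative_linear by blast
    show "onorm (?D x) \<le> L"
    proof (rule onorm_le)
      fix v
      have "?D x v = ?D x (\<Sum>b\<in>Basis. (v \<bullet> b) *\<^sub>R b)" by (simp add: euclidean_representation)
      also have "\<dots> = (\<Sum>b\<in>Basis. (v \<bullet> b) *\<^sub>R ?D x b)"
        using lin by (simp add: linear_sum linear_cmul)
      finally have "norm (?D x v) \<le> (\<Sum>b\<in>Basis. norm ((v \<bullet> b) *\<^sub>R ?D x b))"
        by (simp only: norm_sum)
      also have "\<dots> \<le> (\<Sum>b\<in>Basis. norm v * \<bar>B b\<bar>)"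
        using Basis_le_norm B[OF x]
        by (intro sum_mono) (auto intro!: mult_mono intro: order_trans[OF _ abs_ge_self])
      also have "\<dots> = L * norm v" by (simp add: L_def sum_distrib_left mult.commute)
      finally show "norm (?D x v) \<le> L * norm v" .
    qed
  qed (use that in auto)
  moreover have "0 \<le> L" by (simp add: L_def sum_nonneg)
  ultimately show ?thesis by (auto intro!: exI[of _ L] lipschitz_onI simp: dist_norm)
qed

lemma lipschitz_on_componentwise:
  fixes f :: "'a::metric_space \<Rightarrow> 'b::euclidean_space"
  assumes "\<And>b. b \<in> Basis \<Longrightarrow> \<exists>L. L-lipschitz_on K (\<lambda>x. f x \<bullet> b)"
  shows "\<exists>L. L-lipschitz_on K f"
proof -
  obtain L where L: "\<And>b. b \<in> Basis \<Longrightarrow> (L b)-lipschitz_on K (\<lambda>x. f x \<bullet> b)" using assms by metis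
  have "dist (f x) (f y) \<le> (\<Sum>b\<in>Basis. L b) * dist x y" if "x \<in> K" "y \<in> K" for x y
  proof -
    have "dist (f x) (f y) \<le> (\<Sum>b\<in>Basis. \<bar>(f x - f y) \<bullet> b\<bar>)"
      unfolding dist_norm by (rule norm_le_l1)
    also have "\<dots> \<le> (\<Sum>b\<in>Basis. L b * dist x y)"
      using lipschitz_onD[OF L that] by (intro sum_mono) (auto simp: dist_real_def inner_diff_left)
    finally show ?thesis by (simp add: sum_distrib_right)
  qed
  moreover have "0 \<le> (\<Sum>b\<in>Basis. L b)"
    using lipschitz_on_nonneg[OF L] by (rule sum_nonneg)
  ultimately show ?thesis by (blast intro: lipschitz_onI)
qed

text \<open>On an open set equal functions have equal derivatives, so the claim passes to the
  derivatives by induction. It serves to replace an abstract \<open>frechet_derivative\<close> by an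
  explicit formula.\<close>

lemma Ck_transform:
  assumes S: "open S" and f: "Ck k f S" and eq: "\<And>x. x \<in> S \<Longrightarrow> f x = g x"
  shows "Ck k g S"
  using f eq
proof (induction k arbitrary: f g)
  case 0
  then show ?case using continuous_on_cong[of S S f g] by auto
next
  case (Suc k)
  have der: "(g has_derivative frechet_derivative f (at x)) (at x)" if "x \<in> S" for x
  proof -
    have "(f has_derivative frechet_derivative f (at x)) (at x)"
      using Suc.prems(1) that by (simp add: frechet_derivative_works)
    then show ?thesis
      by (rule has_derivative_transform_within_open[OF _ S that Suc.prems(2)])
  qed
  have "Ck k (\<lambda>x. frechet_derivative g (at x) v) S" for v
  proof (rule Suc.IH)
    show "Ck k (\<lambda>x. frechet_derivative f (at x) v) S" using Suc.prems(1) by simp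
    show "frechet_derivative f (at x) v = frechet_derivative g (at x) v" if "x \<in> S" for x
      using frechet_derivative_at[OF der[OF that]] by simp
  qed
  then show ?case using der by (auto simp: differentiable_def)
qed

lemma Ck_inner:
  assumes S: "open S" and "Ck k f S"
  shows "Ck k (\<lambda>x. f x \<bullet> b) S"
  using assms(2)
proof (induction k arbitrary: f)
  case 0
  then show ?case by (auto intro: continuous_intros)
next
  case (Suc k)
  have der: "((\<lambda>x. f x \<bullet> b) has_derivative (\<lambda>v. frechet_derivative f (at x) v \<bullet> b)) (at x)"
    if "x \<in> S" for x
    using Suc.prems that by (intro has_derivative_inner_left) (simp add: frechet_derivative_works)
  have "Ck k (\<lambda>x. frechet_derivative (\<lambda>x. f x \<bullet> b) (at x) v) S" for v
  proof -
    have "Ck k (\<lambda>x. frechet_derivative f (at x) v \<bullet> b) S"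
      using Suc by auto
    then show ?thesis
      by (rule Ck_transform[OF S]) (simp flip: frechet_derivative_at[OF der])
  qed
  then show ?case using der by (auto simp: differentiable_def)
qed

text \<open>The derivative of the slice along \<open>v\<close> is the derivative of \<open>f\<close>
  along \<open>(0, v)\<close>, which is again a slice of a function of class \<open>Ck k\<close>.
  Applied to the group product in charts, this freezes the left factor.\<close>

lemma Ck_slice:
  assumes T: "open T" and "Ck k f S" and "\<And>a. a \<in> T \<Longrightarrow> (c, a) \<in> S"
  shows "Ck k (\<lambda>a. f (c, a)) T"
  using assms(2)
proof (induction k arbitrary: f)
  case 0
  then show ?case using assms(3)
    by (auto intro!: continuous_on_compose2[of S f] continuous_intros)
next
  case (Suc k)
  have der: "((\<lambda>a. f (c, a)) has_derivative (\<lambda>v. frechet_derivative f (at (c, a)) (0, v))) (at a)"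
    if "a \<in> T" for a
  proof -
    have "(f has_derivative frechet_derivative f (at (c, a))) (at (c, a))"
      using Suc.prems assms(3)[OF that] by (simp add: frechet_derivative_works)
    moreover have "((\<lambda>a. (c, a)) has_derivative (\<lambda>v. (0, v))) (at a)"
      by (auto intro!: derivative_eq_intros)
    ultimately show ?thesis
      by (rule has_derivative_compose[rotated])
  qed
  have "Ck k (\<lambda>a. frechet_derivative (\<lambda>a. f (c, a)) (at a) v) T" for v
  proof -
    have "Ck k (\<lambda>a. frechet_derivative f (at (c, a)) (0, v)) T"
      using Suc by auto
    then show ?thesis
      by (rule Ck_transform[OF T]) (simp flip: frechet_derivative_at[OF der])
  qed
  then show ?case using der by (auto simp: differentiable_def)
qed

section \<open>Integral curves on manifolds\<close>

text \<open>The version of \<open>integral_curve\<close> for a time set. The derivative is taken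
  \<open>at t\<close> and not within \<open>I\<close>, so open \<open>I\<close> is intended.\<close>

definition integral_curve_on ::
    "('g::{t2_space,second_countable_topology} set \<times> ('g \<Rightarrow> 'e::euclidean_space)) set
      \<Rightarrow> 'g vfield \<Rightarrow> real set \<Rightarrow> (real \<Rightarrow> 'g) \<Rightarrow> bool" where
  "integral_curve_on atlas X I \<gamma> \<longleftrightarrow>
     continuous_on I \<gamma> \<and>
     (\<forall>t\<in>I. \<forall>f. smooth_near atlas (\<gamma> t) f \<longrightarrow> (f \<circ> \<gamma> has_real_derivative X (\<gamma> t) f) (at t))"

lemma integral_curve_iff: "integral_curve atlas X \<gamma> \<longleftrightarrow> integral_curve_on atlas X UNIV \<gamma>"
  by (simp add: integral_curve_def integral_curve_on_def)

context smooth_manifold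
begin

section \<open>Charts and smooth coordinate functions\<close>

lemma chart_inv: "(U, \<phi>) \<in> atlas \<Longrightarrow> x \<in> U \<Longrightarrow> inv_into U \<phi> (\<phi> x) = x"
  using chart[of U \<phi>] by (simp add: homeomorphism_def)

lemma chart_open: "(U, \<phi>) \<in> atlas \<Longrightarrow> open U"
  using chart[of U \<phi>] by simp

lemma chart_open_image: "(U, \<phi>) \<in> atlas \<Longrightarrow> open (\<phi> ` U)"
  using chart[of U \<phi>] by simp

lemma chart_continuous: "(U, \<phi>) \<in> atlas \<Longrightarrow> continuous_on U \<phi>"
  using chart[of U \<phi>] by (simp add: homeomorphism_def)

lemma chart_inv_continuous: "(U, \<phi>) \<in> atlas \<Longrightarrow> continuous_on (\<phi> ` U) (inv_into U \<phi>)"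
  using chart[of U \<phi>] by (simp add: homeomorphism_def)

lemma chart_inv_in: "(U, \<phi>) \<in> atlas \<Longrightarrow> a \<in> \<phi> ` U \<Longrightarrow> inv_into U \<phi> a \<in> U \<and> \<phi> (inv_into U \<phi> a) = a"
  by (simp add: inv_into_into f_inv_into_f)

lemma chart_image_open:
  assumes c: "(U, \<phi>) \<in> atlas" and S: "open S"
  shows "open (\<phi> ` (U \<inter> S))"
proof -
  have "openin (top_of_set (\<phi> ` U)) (\<phi> ` (U \<inter> S))"
    using chart[OF c] S by (intro homeomorphism_imp_open_map[of U _ \<phi> "inv_into U \<phi>"]) auto
  then show ?thesis using chart_open_image[OF c] openin_open_trans by blast
qed

lemma chart_exists: obtains U \<phi> where "(U, \<phi>) \<in> atlas" "x \<in> U"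
proof -
  have "x \<in> \<Union> (fst ` atlas)" by (simp add: charts_cover)
  then show thesis using that by auto
qed

text \<open>This is chart compatibility, read one component at a time. It makes coordinates
  admissible test functions for vector fields and integral curves.\<close>

lemma smooth_fun_on_coordinate:
  assumes c: "(U, \<phi>) \<in> atlas"
  shows "smooth_fun_on atlas U (\<lambda>q. \<phi> q \<bullet> b)"
  unfolding smooth_fun_on_def smooth_on_def
proof clarify
  fix V \<psi> k assume c': "(V, \<psi>) \<in> atlas"
  have "Ck k (\<phi> \<circ> inv_into V \<psi>) (\<psi> ` (V \<inter> U))"
    using charts_compatible[OF c' c] by (auto simp: smooth_on_def)
  then have "Ck k (\<lambda>a. (\<phi> \<circ> inv_into V \<psi>) a \<bullet> b) (\<psi> ` (V \<inter> U))"
    by (intro Ck_inner chart_image_open c' chart_open[OF c])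
  then show "Ck k ((\<lambda>q. \<phi> q \<bullet> b) \<circ> inv_into V \<psi>) (\<psi> ` (V \<inter> U))"
    by (simp add: o_def)
qed

lemma smooth_near_coordinate:
  "(U, \<phi>) \<in> atlas \<Longrightarrow> p \<in> U \<Longrightarrow> smooth_near atlas p (\<lambda>q. \<phi> q \<bullet> b)"
  unfolding smooth_near_def using smooth_fun_on_coordinate[of U \<phi> b] chart_open[of U \<phi>] by blast

lemma smooth_near_differentiable:
  assumes "smooth_near atlas p f" "(U, \<phi>) \<in> atlas" "p \<in> U"
  shows "(f \<circ> inv_into U \<phi>) differentiable (at (\<phi> p))"
proof -
  obtain S where S: "p \<in> S" "smooth_fun_on atlas S f" using assms(1) by (auto simp: smooth_near_def)
  then have "smooth_on (\<phi> ` (U \<inter> S)) (f \<circ> inv_into U \<phi>)"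
    using assms(2) by (auto simp: smooth_fun_on_def)
  then have "Ck 1 (f \<circ> inv_into U \<phi>) (\<phi> ` (U \<inter> S))" by (auto simp: smooth_on_def)
  then show ?thesis using S assms(3) by auto
qed

section \<open>Tangent vectors and integral curves in coordinates\<close>

definition chart_vector :: "('g \<Rightarrow> 'e) \<Rightarrow> (('g \<Rightarrow> real) \<Rightarrow> real) \<Rightarrow> 'e" where
  "chart_vector \<phi> v = (\<Sum>b\<in>Basis. v (\<lambda>q. \<phi> q \<bullet> b) *\<^sub>R b)"

lemma chart_vector_inner [simp]: "b \<in> Basis \<Longrightarrow> chart_vector \<phi> v \<bullet> b = v (\<lambda>q. \<phi> q \<bullet> b)"
  by (simp add: chart_vector_def)

text \<open>Near \<open>t\<close> the curve stays in \<open>U\<close>, so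
  \<open>f \<circ> \<gamma>\<close> factors there through the chart as
  \<open>f \<circ> inv_into U \<phi>\<close> after \<open>\<phi> \<circ> \<gamma>\<close>.\<close>

lemma curve_chain_rule:
  assumes c: "(U, \<phi>) \<in> atlas" and U: "\<gamma> t \<in> U"
    and f: "smooth_near atlas (\<gamma> t) f"
    and I: "open I" "t \<in> I" "continuous_on I \<gamma>"
    and der: "((\<lambda>s. \<phi> (\<gamma> s)) has_vector_derivative w) (at t)"
  shows "(f \<circ> \<gamma> has_real_derivative frechet_derivative (f \<circ> inv_into U \<phi>) (at (\<phi> (\<gamma> t))) w) (at t)"
proof -
  let ?D = "frechet_derivative (f \<circ> inv_into U \<phi>) (at (\<phi> (\<gamma> t)))"
  have D: "((f \<circ> inv_into U \<phi>) has_derivative ?D) (at (\<phi> (\<gamma> t)))"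
    using smooth_near_differentiable[OF f c U] by (simp only: frechet_derivative_works)
  have "((\<lambda>s. (f \<circ> inv_into U \<phi>) (\<phi> (\<gamma> s))) has_derivative (\<lambda>u. ?D (u *\<^sub>R w))) (at t)"
    using der D unfolding has_vector_derivative_def by (rule has_derivative_compose)
  moreover have "open (I \<inter> \<gamma> -` U)"
    using I chart_open[OF c] by (simp add: continuous_on_open_vimage Int_commute)
  ultimately have "(f \<circ> \<gamma> has_derivative (\<lambda>u. ?D (u *\<^sub>R w))) (at t)"
    by (rule has_derivative_transform_within_open) (use I U c in \<open>auto simp: chart_inv\<close>)
  then show ?thesis
    using has_derivative_linear[OF D] by (simp add: has_field_derivative_def linear_cmul mult_commute_abs)
qed

text \<open>A tangent vector is the velocity of some curve. The chain rule for that curve, together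
  with the identification of its coordinate velocity with \<open>chart_vector \<phi> v\<close>,
  shows that \<open>v\<close> is determined by its values on coordinates.\<close>

lemma tangent_vector_chart:
  assumes v: "v \<in> tangent_space atlas p" and c: "(U, \<phi>) \<in> atlas" and p: "p \<in> U"
    and f: "smooth_near atlas p f"
  shows "v f = frechet_derivative (f \<circ> inv_into U \<phi>) (at (\<phi> p)) (chart_vector \<phi> v)"
proof -
  obtain \<gamma> e where e: "0 < e" and \<gamma>: "smooth_curve_on atlas {-e<..<e} \<gamma>" "\<gamma> 0 = p"
    and v_eq: "v = velocity atlas \<gamma>"
    using v by (auto simp: tangent_space_def)
  have cont: "continuous_on {-e<..<e} \<gamma>" using \<gamma>(1) by (simp add: smooth_curve_on_def)
  have "Ck 1 (\<phi> \<circ> \<gamma>) ({-e<..<e} \<inter> \<gamma> -` U)"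
    using \<gamma>(1) c unfolding smooth_curve_on_def smooth_on_def by blast
  then have "(\<phi> \<circ> \<gamma>) differentiable (at 0)" using e \<gamma>(2) p by auto
  then obtain w where w: "((\<lambda>s. \<phi> (\<gamma> s)) has_vector_derivative w) (at 0)"
    by (auto simp: o_def vector_derivative_works)
  have v_app: "v g = deriv (g \<circ> \<gamma>) 0" if "smooth_near atlas p g" for g
    using that by (simp add: v_eq velocity_def \<gamma>(2))
  have "v (\<lambda>q. \<phi> q \<bullet> b) = w \<bullet> b" for b
  proof -
    have "((\<lambda>s. \<phi> (\<gamma> s) \<bullet> b) has_vector_derivative w \<bullet> b) (at 0)"
      using has_derivative_inner_left[OF w[unfolded has_vector_derivative_def], of b]
      by (simp add: has_vector_derivative_def)
    then have "deriv ((\<lambda>q. \<phi> q \<bullet> b) \<circ> \<gamma>) 0 = w \<bullet> b"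
      by (intro DERIV_imp_deriv) (simp add: o_def has_real_derivative_iff_has_vector_derivative)
    then show ?thesis using v_app[OF smooth_near_coordinate[OF c p]] by simp
  qed
  then have "chart_vector \<phi> v = w" by (simp add: chart_vector_def euclidean_representation)
  moreover have "v f = frechet_derivative (f \<circ> inv_into U \<phi>) (at (\<phi> p)) w"
    using curve_chain_rule[of U \<phi> \<gamma> 0 f "{-e<..<e}" w] c p f e cont w \<gamma>(2)
    by (simp add: v_app[OF f] DERIV_imp_deriv)
  ultimately show ?thesis by simp
qed

lemma has_vector_derivative_chart_iff:
  "((\<lambda>s. \<phi> (\<gamma> s)) has_vector_derivative chart_vector \<phi> v) (at t) \<longleftrightarrow>
    (\<forall>b\<in>Basis. ((\<lambda>q. \<phi> q \<bullet> b) \<circ> \<gamma> has_real_derivative v (\<lambda>q. \<phi> q \<bullet> b)) (at t))"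
  unfolding has_vector_derivative_def has_field_derivative_def
  by (subst has_derivative_componentwise_within) (simp add: o_def mult_commute_abs)

lemma integral_curve_on_chart:
  assumes "integral_curve_on atlas X I \<gamma>" "t \<in> I" "(U, \<phi>) \<in> atlas" "\<gamma> t \<in> U"
  shows "((\<lambda>s. \<phi> (\<gamma> s)) has_vector_derivative chart_vector \<phi> (X (\<gamma> t))) (at t)"
  unfolding has_vector_derivative_chart_iff
  using assms(1,2) smooth_near_coordinate[OF assms(3,4)] unfolding integral_curve_on_def by blast

text \<open>One chart around each point is enough: for every test function both sides of the
  differential equation are the derivative of its chart expression applied to the same coordinate
  vector.\<close>

lemma integral_curve_onI:
  assumes X: "vector_field atlas X" and I: "open I" and cont: "continuous_on I \<gamma>"
    and der: "\<And>t. t \<in> I \<Longrightarrow> \<exists>U \<phi>. (U, \<phi>) \<in> atlas \<and> \<gamma> t \<in> U \<and>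
      ((\<lambda>s. \<phi> (\<gamma> s)) has_vector_derivative chart_vector \<phi> (X (\<gamma> t))) (at t)"
  shows "integral_curve_on atlas X I \<gamma>"
  unfolding integral_curve_on_def
proof (intro conjI ballI allI impI cont)
  fix t f assume t: "t \<in> I" and f: "smooth_near atlas (\<gamma> t) f"
  obtain U \<phi> where c: "(U, \<phi>) \<in> atlas" "\<gamma> t \<in> U"
    and d: "((\<lambda>s. \<phi> (\<gamma> s)) has_vector_derivative chart_vector \<phi> (X (\<gamma> t))) (at t)"
    using der[OF t] by blast
  have "X (\<gamma> t) \<in> tangent_space atlas (\<gamma> t)" using X by (simp add: vector_field_def)
  then show "(f \<circ> \<gamma> has_real_derivative X (\<gamma> t) f) (at t)"
    using curve_chain_rule[OF c f I t cont d] tangent_vector_chart[OF _ c f] by simp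
qed

text \<open>The components of the field in a chart are \<open>X\<close> applied to coordinate
  functions, hence smooth, hence Lipschitz on a closed ball inside the chart image.\<close>

lemma vector_field_chart_lipschitz:
  assumes X: "vector_field atlas X" and c: "(U, \<phi>) \<in> atlas" and p: "p \<in> U"
  shows "\<exists>r>0. cball (\<phi> p) r \<subseteq> \<phi> ` U \<and>
    (\<exists>L. L-lipschitz_on (cball (\<phi> p) r) (\<lambda>a. chart_vector \<phi> (X (inv_into U \<phi> a))))"
proof -
  obtain r where r: "0 < r" "cball (\<phi> p) r \<subseteq> \<phi> ` U"
    using chart_open_image[OF c] p open_contains_cball by blast
  have "\<exists>L. L-lipschitz_on (cball (\<phi> p) r) (\<lambda>a. chart_vector \<phi> (X (inv_into U \<phi> a)) \<bullet> b)"
    if b: "b \<in> Basis" for b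
  proof -
    have "smooth_fun_on atlas U (\<lambda>q. X q (\<lambda>q. \<phi> q \<bullet> b))"
      using X smooth_fun_on_coordinate[OF c] chart_open[OF c] by (simp add: vector_field_def)
    then have "Ck 1 ((\<lambda>q. X q (\<lambda>q. \<phi> q \<bullet> b)) \<circ> inv_into U \<phi>) (\<phi> ` (U \<inter> U))"
      using c unfolding smooth_fun_on_def smooth_on_def by blast
    then show ?thesis using Ck_1_lipschitz[of _ "\<phi> ` U" "cball (\<phi> p) r"] r b by (simp add: o_def)
  qed
  then have "\<exists>L. L-lipschitz_on (cball (\<phi> p) r) (\<lambda>a. chart_vector \<phi> (X (inv_into U \<phi> a)))"
    by (rule lipschitz_on_componentwise)
  then show ?thesis using r by blast
qed

section \<open>Existence and uniqueness of integral curves\<close>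

lemma integral_curve_exists_local:
  assumes X: "vector_field atlas X"
  shows "\<exists>h>0. \<exists>\<gamma>. \<gamma> 0 = p \<and> integral_curve_on atlas X {-h<..<h} \<gamma>"
proof -
  obtain U \<phi> where c: "(U, \<phi>) \<in> atlas" "p \<in> U" using chart_exists by blast
  let ?F = "\<lambda>a. chart_vector \<phi> (X (inv_into U \<phi> a))"
  obtain r L where r: "0 < r" "cball (\<phi> p) r \<subseteq> \<phi> ` U" "L-lipschitz_on (cball (\<phi> p) r) ?F"
    using vector_field_chart_lipschitz[OF X c] by blast
  obtain h x where h: "0 < h" and x0: "x 0 = \<phi> p"
    and x: "\<And>t. t \<in> {-h<..<h} \<Longrightarrow> x t \<in> ball (\<phi> p) r"
      "\<And>t. t \<in> {-h<..<h} \<Longrightarrow> (x has_vector_derivative ?F (x t)) (at t)"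
    using picard_lindelof[OF r(1,3)] by blast
  have xU: "x t \<in> \<phi> ` U" if "t \<in> {-h<..<h}" for t using x(1)[OF that] r(2) by auto
  define \<gamma> where "\<gamma> t = inv_into U \<phi> (x t)" for t
  have "continuous_on {-h<..<h} x"
    using x(2) has_vector_derivative_continuous by (blast intro: continuous_at_imp_continuous_on)
  then have cont: "continuous_on {-h<..<h} \<gamma>"
    unfolding \<gamma>_def using xU by (intro continuous_on_compose2[OF chart_inv_continuous[OF c(1)]]) auto
  have \<gamma>: "\<gamma> t \<in> U" "\<phi> (\<gamma> t) = x t" if "t \<in> {-h<..<h}" for t
    using chart_inv_in[OF c(1) xU[OF that]] by (auto simp: \<gamma>_def)
  have "((\<lambda>s. \<phi> (\<gamma> s)) has_vector_derivative chart_vector \<phi> (X (\<gamma> t))) (at t)"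
    if t: "t \<in> {-h<..<h}" for t
    by (rule has_vector_derivative_transform_within_open[OF x(2)[OF t, folded \<gamma>_def], of "{-h<..<h}"])
      (use t \<gamma> in auto)
  then have "integral_curve_on atlas X {-h<..<h} \<gamma>"
    using \<gamma> c by (intro integral_curve_onI[OF X _ cont]) auto
  moreover have "\<gamma> 0 = p" using x0 c by (simp add: \<gamma>_def chart_inv)
  ultimately show ?thesis using h by blast
qed

lemma integral_curve_unique_local:
  assumes X: "vector_field atlas X" and I: "open I" "t0 \<in> I"
    and \<gamma>: "integral_curve_on atlas X I \<gamma>" and \<eta>: "integral_curve_on atlas X I \<eta>"
    and eq: "\<gamma> t0 = \<eta> t0"
  shows "\<exists>d>0. \<forall>t\<in>ball t0 d. \<gamma> t = \<eta> t"
proof -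
  obtain U \<phi> where c: "(U, \<phi>) \<in> atlas" "\<gamma> t0 \<in> U" using chart_exists by blast
  let ?F = "\<lambda>a. chart_vector \<phi> (X (inv_into U \<phi> a))"
  obtain r L where r: "0 < r" "L-lipschitz_on (cball (\<phi> (\<gamma> t0)) r) ?F"
    using vector_field_chart_lipschitz[OF X c] by blast
  \<comment> \<open>The part of the chart domain that is mapped into the Lipschitz ball. Both curves
    start in this open set and remain in it for a short time, so uniqueness in Euclidean space
    applies.\<close>
  define B where "B = U \<inter> \<phi> -` ball (\<phi> (\<gamma> t0)) r"
  have B: "open B"
    unfolding B_def using chart_continuous[OF c(1)] chart_open[OF c(1)]
    by (simp add: continuous_on_open_vimage Int_commute)
  have near: "\<exists>d>0. ball t0 d \<subseteq> I \<inter> \<zeta> -` B"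
    if "integral_curve_on atlas X I \<zeta>" "\<zeta> t0 = \<gamma> t0" for \<zeta>
  proof -
    have "open (I \<inter> \<zeta> -` B)"
      using that(1) I(1) B by (simp add: integral_curve_on_def continuous_on_open_vimage Int_commute)
    moreover have "t0 \<in> I \<inter> \<zeta> -` B" using that(2) I(2) c(2) r(1) by (simp add: B_def)
    ultimately show ?thesis by (auto simp: open_contains_ball)
  qed
  obtain d1 where d1: "0 < d1" "ball t0 d1 \<subseteq> I \<inter> \<gamma> -` B" using near[OF \<gamma>] by blast
  obtain d2 where d2: "0 < d2" "ball t0 d2 \<subseteq> I \<inter> \<eta> -` B" using near[OF \<eta>] eq by auto
  define e where "e = min d1 d2"
  have sol: "\<phi> (\<zeta> t) \<in> cball (\<phi> (\<gamma> t0)) r \<and>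
      ((\<lambda>s. \<phi> (\<zeta> s)) has_vector_derivative ?F (\<phi> (\<zeta> t))) (at t)"
    if "integral_curve_on atlas X I \<zeta>" "t \<in> I" "\<zeta> t \<in> B" for \<zeta> t
    using integral_curve_on_chart[OF that(1,2) c(1)] that(3) c(1) by (auto simp: B_def chart_inv)
  obtain d where d: "0 < d" "\<And>t. t \<in> ball t0 d \<Longrightarrow> \<phi> (\<gamma> t) = \<phi> (\<eta> t)"
    using ode_unique_local[OF r(2), of e t0 "\<lambda>s. \<phi> (\<gamma> s)" "\<lambda>s. \<phi> (\<eta> s)"] sol[OF \<gamma>] sol[OF \<eta>] d1 d2 eq
    by (auto simp: e_def subset_iff)
  have "\<gamma> t = \<eta> t" if "t \<in> ball t0 (min d e)" for t
  proof -
    have "\<gamma> t \<in> U" "\<eta> t \<in> U" using that d1(2) d2(2) by (auto simp: e_def B_def subset_iff)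
    then show ?thesis using d(2)[of t] that chart_inv[OF c(1)] by (metis ball_min_Int IntD1)
  qed
  then show ?thesis using d(1) d1(1) d2(1) by (intro exI[of _ "min d e"]) (auto simp: e_def)
qed

lemma integral_curve_on_subset:
  "integral_curve_on atlas X I \<gamma> \<Longrightarrow> J \<subseteq> I \<Longrightarrow> integral_curve_on atlas X J \<gamma>"
  by (auto simp: integral_curve_on_def intro: continuous_on_subset)

text \<open>A connectedness argument: the agreement set is open by local uniqueness, and its
  complement in \<open>I\<close> is open because the space is Hausdorff.\<close>

lemma integral_curve_unique:
  assumes X: "vector_field atlas X" and I: "open I" "connected I" "t0 \<in> I"
    and \<gamma>: "integral_curve_on atlas X I \<gamma>" and \<eta>: "integral_curve_on atlas X I \<eta>"
    and eq: "\<gamma> t0 = \<eta> t0" and t: "t \<in> I"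
  shows "\<gamma> t = \<eta> t"
proof -
  let ?A = "{t \<in> I. \<gamma> t = \<eta> t}" and ?B = "{t \<in> I. \<gamma> t \<noteq> \<eta> t}"
  have "open ?A"
    unfolding open_contains_ball
  proof clarify
    fix u assume u: "u \<in> I" "\<gamma> u = \<eta> u"
    obtain d where "0 < d" "\<forall>t\<in>ball u d. \<gamma> t = \<eta> t"
      using integral_curve_unique_local[OF X I(1) u(1) \<gamma> \<eta> u(2)] by blast
    moreover obtain e where "0 < e" "ball u e \<subseteq> I" using I(1) u(1) open_contains_ball by blast
    ultimately show "\<exists>e>0. ball u e \<subseteq> ?A"
      by (intro exI[of _ "min d e"]) auto
  qed
  moreover have "open ?B"
  proof -
    have "continuous_on I (\<lambda>t. (\<gamma> t, \<eta> t))"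
      using \<gamma> \<eta> by (intro continuous_on_Pair) (simp_all add: integral_curve_on_def)
    then have "open ((\<lambda>t. (\<gamma> t, \<eta> t)) -` {(x, y) | x y. x \<noteq> y} \<inter> I)"
      using continuous_on_open_vimage[OF I(1)] open_diagonal_complement by blast
    also have "(\<lambda>t. (\<gamma> t, \<eta> t)) -` {(x, y) | x y. x \<noteq> y} \<inter> I = ?B" by auto
    finally show ?thesis .
  qed
  ultimately have "?A \<inter> I = {} \<or> ?B \<inter> I = {}"
    by (intro connectedD[OF I(2)]) auto
  then show ?thesis using I(3) eq t by blast
qed

end

section \<open>The exponential map and monotone sets\<close>

text \<open>Continuity and the differential equation are local in time; this permits gluing pieces
  that agree on overlapping intervals.\<close>

lemma (in smooth_manifold) integral_curve_on_localI:
  assumes "\<And>t. t \<in> I \<Longrightarrow> \<exists>J \<eta>. open J \<and> t \<in> J \<and> integral_curve_on atlas X J \<eta> \<and> (\<forall>s\<in>J. \<gamma> s = \<eta> s)"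
  shows "integral_curve_on atlas X I \<gamma>"
proof -
  have "isCont \<gamma> t \<and>
      (\<forall>f. smooth_near atlas (\<gamma> t) f \<longrightarrow> (f \<circ> \<gamma> has_real_derivative X (\<gamma> t) f) (at t))"
    if t: "t \<in> I" for t
  proof -
    obtain J \<eta> where J: "open J" "t \<in> J" "integral_curve_on atlas X J \<eta>" "\<And>s. s \<in> J \<Longrightarrow> \<gamma> s = \<eta> s"
      using assms[OF t] by blast
    have "continuous_on J \<gamma>"
      using J continuous_on_cong[of J J \<gamma> \<eta>] by (simp add: integral_curve_on_def)
    then have "isCont \<gamma> t" using J(1,2) continuous_on_eq_continuous_at by blast
    moreover have "(f \<circ> \<gamma> has_real_derivative X (\<gamma> t) f) (at t)" if "smooth_near atlas (\<gamma> t) f" for f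
    proof -
      have "(f \<circ> \<eta> has_real_derivative X (\<gamma> t) f) (at t)"
        using J(2,3,4) that by (auto simp: integral_curve_on_def)
      then show ?thesis
        using J by (elim has_field_derivative_transform_within_open) auto
    qed
    ultimately show ?thesis by blast
  qed
  then show ?thesis
    by (auto simp: integral_curve_on_def intro: continuous_at_imp_continuous_on)
qed

lemma (in smooth_manifold) integral_curve_on_shift:
  assumes "integral_curve_on atlas X I \<gamma>"
  shows "integral_curve_on atlas X {s. s + c \<in> I} (\<lambda>s. \<gamma> (s + c))"
  using assms DERIV_shift[of "f \<circ> \<gamma>" _ _ c for f]
  by (auto simp: integral_curve_on_def o_def
      intro!: continuous_on_compose2[of I \<gamma>] continuous_intros)

context lie_group
begin

lemma in_carrier [simp]: "x \<in> carrier G"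
  by (simp add: carrier_UNIV)

section \<open>Left translation and completeness of left-invariant fields\<close>

lemma continuous_left_mult:
  assumes "continuous_on A f"
  shows "continuous_on A (\<lambda>t. g \<otimes> f t)"
proof -
  have "continuous_on A (\<lambda>t. (g, f t))" using assms by (intro continuous_intros)
  then show ?thesis using continuous_on_compose2[OF continuous_mult] by fastforce
qed

lemma smooth_near_translated_coordinate:
  assumes c: "(Z, \<theta>) \<in> atlas" and q: "g \<otimes> q \<in> Z"
  shows "smooth_near atlas q (\<lambda>y. \<theta> (g \<otimes> y) \<bullet> b)"
proof -
  define S where "S = (\<lambda>y. g \<otimes> y) -` Z"
  have S: "open S"
    unfolding S_def using chart_open[OF c] by (intro open_vimage continuous_left_mult continuous_on_id)
  obtain U \<phi> where c1: "(U, \<phi>) \<in> atlas" "g \<in> U" using chart_exists by blast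
  have "smooth_fun_on atlas S (\<lambda>y. \<theta> (g \<otimes> y) \<bullet> b)"
    unfolding smooth_fun_on_def smooth_on_def
  proof clarify
    fix V \<psi> k assume c2: "(V, \<psi>) \<in> atlas"
    let ?H = "\<lambda>(a, b). \<theta> (inv_into U \<phi> a \<otimes> inv_into V \<psi> b)"
    have opn: "open (\<psi> ` (V \<inter> S))" by (rule chart_image_open[OF c2 S])
    have "Ck k ?H {(\<phi> x, \<psi> y) | x y. x \<in> U \<and> y \<in> V \<and> x \<otimes> y \<in> Z}"
      using smooth_mult[OF c1(1) c2 c] by (simp add: smooth_on_def)
    \<comment> \<open>Smoothness of the product is known jointly in two charts; fixing the first
      coordinate at \<open>\<phi> g\<close> gives left translation by \<open>g\<close>.\<close>
    then have "Ck k (\<lambda>a. ?H (\<phi> g, a)) (\<psi> ` (V \<inter> S))"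
      using c1(2) by (intro Ck_slice[OF opn]) (auto simp: S_def)
    then have "Ck k (\<lambda>a. ?H (\<phi> g, a) \<bullet> b) (\<psi> ` (V \<inter> S))" by (rule Ck_inner[OF opn])
    then show "Ck k ((\<lambda>y. \<theta> (g \<otimes> y) \<bullet> b) \<circ> inv_into V \<psi>) (\<psi> ` (V \<inter> S))"
      by (simp add: o_def chart_inv[OF c1])
  qed
  then show ?thesis using S q by (auto simp: smooth_near_def S_def)
qed

text \<open>Testing the translated curve on a coordinate is testing \<open>\<gamma>\<close> on the
  translated coordinate, and left invariance identifies the two values of \<open>X\<close>.\<close>

lemma integral_curve_on_translate:
  assumes X: "X \<in> lie_algebra atlas G" and I: "open I" and \<gamma>: "integral_curve_on atlas X I \<gamma>"
  shows "integral_curve_on atlas X I (\<lambda>t. g \<otimes> \<gamma> t)"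
proof (rule integral_curve_onI[OF _ I])
  show "vector_field atlas X" using X by (simp add: lie_algebra_def)
  show "continuous_on I (\<lambda>t. g \<otimes> \<gamma> t)"
    using \<gamma> by (intro continuous_left_mult) (simp add: integral_curve_on_def)
  fix t assume t: "t \<in> I"
  obtain Z \<theta> where c: "(Z, \<theta>) \<in> atlas" "g \<otimes> \<gamma> t \<in> Z" using chart_exists by blast
  have "((\<lambda>q. \<theta> q \<bullet> b) \<circ> (\<lambda>t. g \<otimes> \<gamma> t) has_real_derivative X (g \<otimes> \<gamma> t) (\<lambda>q. \<theta> q \<bullet> b)) (at t)" for b
  proof -
    have "((\<lambda>y. \<theta> (g \<otimes> y) \<bullet> b) \<circ> \<gamma> has_real_derivative X (\<gamma> t) (\<lambda>y. \<theta> (g \<otimes> y) \<bullet> b)) (at t)"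
      using \<gamma> t smooth_near_translated_coordinate[OF c] unfolding integral_curve_on_def by blast
    then show ?thesis using X by (simp add: o_def lie_algebra_def left_invariant_def)
  qed
  then show "\<exists>U \<phi>. (U, \<phi>) \<in> atlas \<and> g \<otimes> \<gamma> t \<in> U \<and>
      ((\<lambda>s. \<phi> (g \<otimes> \<gamma> s)) has_vector_derivative chart_vector \<phi> (X (g \<otimes> \<gamma> t))) (at t)"
    using c has_vector_derivative_chart_iff[of \<theta> "\<lambda>t. g \<otimes> \<gamma> t"] by blast
qed

text \<open>Translating the local curve through the identity gives a curve through any point on a
  time interval of the same length, so prolongation by a fixed step never stops.\<close>

lemma integral_curve_exists:
  assumes X: "X \<in> lie_algebra atlas G"
  shows "\<exists>\<gamma>. integral_curve atlas X \<gamma> \<and> \<gamma> 0 = \<one>"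
proof -
  have vf: "vector_field atlas X" using X by (simp add: lie_algebra_def)
  obtain h \<gamma> where h: "0 < h" and \<gamma>0: "\<gamma> 0 = \<one>" and \<gamma>: "integral_curve_on atlas X {-h<..<h} \<gamma>"
    using integral_curve_exists_local[OF vf] by blast
  \<comment> \<open>With half of the local lifetime as step, \<open>u + \<delta>\<close> stays in
    the domain of \<open>\<gamma>\<close> for all \<open>u\<close> in
    \<open>{-h<..<\<delta>}\<close>, an interval containing
    \<open>{-\<delta>..<\<delta>}\<close>.\<close>
  define \<delta> where "\<delta> = h / 2"
  have \<delta>: "0 < \<delta>" using h by (simp add: \<delta>_def)
  define a where "a = \<gamma> \<delta>"
  \<comment> \<open>Both sides are integral curves of \<open>X\<close> with value \<open>a\<close>
    at time 0, so uniqueness makes them equal.\<close>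
  have shift: "\<gamma> (u + \<delta>) = a \<otimes> \<gamma> u" if u: "u \<in> {-\<delta>..<\<delta>}" for u
  proof (rule integral_curve_unique[OF vf, of "{-h<..<\<delta>}" 0 "\<lambda>u. \<gamma> (u + \<delta>)" "\<lambda>u. a \<otimes> \<gamma> u"])
    show "integral_curve_on atlas X {-h<..<\<delta>} (\<lambda>u. \<gamma> (u + \<delta>))"
      using \<delta> by (intro integral_curve_on_subset[OF integral_curve_on_shift[OF \<gamma>]]) (auto simp: \<delta>_def)
    show "integral_curve_on atlas X {-h<..<\<delta>} (\<lambda>u. a \<otimes> \<gamma> u)"
      using h by (intro integral_curve_on_subset[OF integral_curve_on_translate[OF X _ \<gamma>]]) (auto simp: \<delta>_def)
  qed (use h u in \<open>auto simp: \<delta>_def \<gamma>0 a_def\<close>)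
  \<comment> \<open>By \<open>shift\<close> the left translates of \<open>\<gamma>\<close> by powers of \<open>\<gamma> \<delta>\<close> agree on overlaps, so the
    local curve extends to the whole real line.\<close>
  define \<Gamma> where "\<Gamma> t = a [^] \<lfloor>t / \<delta>\<rfloor> \<otimes> \<gamma> (t - \<lfloor>t / \<delta>\<rfloor> * \<delta>)" for t
  define J where "J k = {k * \<delta> - \<delta><..<k * \<delta> + \<delta>}" for k :: int
  \<comment> \<open>On the left half of \<open>J k\<close> the floor is \<open>k - 1\<close>, and
    \<open>shift\<close> absorbs the extra factor \<open>a\<close>. One formula is thus valid across
    the jump of the floor at \<open>k * \<delta>\<close>, and the open intervals \<open>J k\<close>
    cover the line.\<close>
  have \<Gamma>_eq: "\<Gamma> s = a [^] k \<otimes> \<gamma> (s - k * \<delta>)" if s: "s \<in> J k" for s k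
  proof (cases "s < k * \<delta>")
    case False
    then have "\<lfloor>s / \<delta>\<rfloor> = k"
      using s \<delta> by (intro floor_unique) (auto simp: J_def field_simps)
    then show ?thesis by (simp add: \<Gamma>_def)
  next
    case True
    then have fl: "\<lfloor>s / \<delta>\<rfloor> = k - 1"
      using s \<delta> by (intro floor_unique) (auto simp: J_def field_simps)
    have arg: "s - real_of_int (k - 1) * \<delta> = (s - k * \<delta>) + \<delta>" by (simp add: algebra_simps)
    have "\<gamma> ((s - k * \<delta>) + \<delta>) = a \<otimes> \<gamma> (s - k * \<delta>)"
      using s True by (intro shift) (auto simp: J_def)
    then have "\<Gamma> s = a [^] (k - 1) \<otimes> (a \<otimes> \<gamma> (s - k * \<delta>))"
      unfolding \<Gamma>_def fl arg by simp
    also have "\<dots> = (a [^] (k - 1) \<otimes> a [^] (1::int)) \<otimes> \<gamma> (s - k * \<delta>)" by (simp add: m_assoc)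
    also have "\<dots> = a [^] k \<otimes> \<gamma> (s - k * \<delta>)" by (subst int_pow_mult[symmetric]) auto
    finally show ?thesis .
  qed
  have J_curve: "integral_curve_on atlas X (J k) (\<lambda>s. a [^] k \<otimes> \<gamma> (s - k * \<delta>))" for k
  proof (rule integral_curve_on_translate[OF X])
    show "integral_curve_on atlas X (J k) (\<lambda>s. \<gamma> (s - k * \<delta>))"
    proof -
      have "J k \<subseteq> {s. s + - (k * \<delta>) \<in> {-h<..<h}}" using h by (auto simp: J_def \<delta>_def)
      then show ?thesis
        using integral_curve_on_subset[OF integral_curve_on_shift[OF \<gamma>, of "- (k * \<delta>)"]] by simp
    qed
  qed (simp add: J_def)
  have J_mem: "t \<in> J \<lfloor>t / \<delta>\<rfloor>" for t
  proof -
    have "\<lfloor>t / \<delta>\<rfloor> * \<delta> - \<delta> < t" using floor_divide_lower[OF \<delta>, of t] \<delta> by linarith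
    moreover have "t < \<lfloor>t / \<delta>\<rfloor> * \<delta> + \<delta>"
      using floor_divide_upper[OF \<delta>, of t] by (simp only: distrib_right mult_1)
    ultimately show ?thesis by (simp add: J_def)
  qed
  have "integral_curve_on atlas X UNIV \<Gamma>"
  proof (rule integral_curve_on_localI, intro exI conjI ballI)
    fix t :: real
    show "open (J \<lfloor>t / \<delta>\<rfloor>)" by (simp add: J_def)
    show "\<Gamma> s = a [^] \<lfloor>t / \<delta>\<rfloor> \<otimes> \<gamma> (s - \<lfloor>t / \<delta>\<rfloor> * \<delta>)" if "s \<in> J \<lfloor>t / \<delta>\<rfloor>" for s
      by (rule \<Gamma>_eq[OF that])
  qed (rule J_mem J_curve)+
  moreover have "\<Gamma> 0 = \<one>" by (simp add: \<Gamma>_def \<gamma>0)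
  ultimately show ?thesis by (auto simp: integral_curve_iff)
qed

section \<open>The exponential map along a ray\<close>

lemma lie_exp_eq:
  assumes X: "X \<in> lie_algebra atlas G" and \<gamma>: "integral_curve atlas X \<gamma>" "\<gamma> 0 = \<one>"
  shows "lie_exp atlas G X = \<gamma> 1"
proof -
  have vf: "vector_field atlas X" using X by (simp add: lie_algebra_def)
  \<comment> \<open>Uniqueness on the whole line is what makes the definite description denote
    \<open>\<gamma>\<close>.\<close>
  have "(THE \<gamma>. integral_curve atlas X \<gamma> \<and> \<gamma> 0 = \<one>) = \<gamma>"
    using \<gamma> integral_curve_unique[OF vf, of UNIV 0]
    by (intro the_equality) (auto simp: integral_curve_iff)
  then show ?thesis by (simp add: lie_exp_def)
qed

lemma integral_curve_scaleR:
  assumes "integral_curve atlas X \<gamma>"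
  shows "integral_curve atlas (c *\<^sub>R X) (\<lambda>t. \<gamma> (c * t))"
proof -
  have "(f \<circ> (\<lambda>t. \<gamma> (c * t)) has_real_derivative (c *\<^sub>R X) (\<gamma> (c * t)) f) (at t)"
    if "smooth_near atlas (\<gamma> (c * t)) f" for t f
  proof -
    have "(f \<circ> \<gamma> has_real_derivative X (\<gamma> (c * t)) f) (at (c * t))"
      using assms that by (simp add: integral_curve_def)
    then have "((f \<circ> \<gamma>) \<circ> (\<lambda>t. c * t) has_real_derivative X (\<gamma> (c * t)) f * c) (at t)"
      by (rule DERIV_chain) (auto intro!: derivative_eq_intros)
    then show ?thesis by (simp add: o_def scaleR_fun_def mult.commute)
  qed
  then show ?thesis using assms
    by (auto simp: integral_curve_def intro!: continuous_on_compose2[of UNIV \<gamma>] continuous_intros)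
qed

text \<open>Reparametrising time identifies the exponential of \<open>t *\<^sub>R X\<close> with the
  value at \<open>t\<close> of the single integral curve of \<open>X\<close> through the identity,
  which is continuous at 0.\<close>

lemma lie_exp_scaleR_tendsto_one:
  assumes "X \<in> lie_algebra atlas G" and W: "\<And>t. 0 < t \<Longrightarrow> t *\<^sub>R X \<in> lie_algebra atlas G"
  shows "((\<lambda>t. lie_exp atlas G (t *\<^sub>R X)) \<longlongrightarrow> \<one>) (at_right 0)"
proof -
  obtain \<gamma> where \<gamma>: "integral_curve atlas X \<gamma>" "\<gamma> 0 = \<one>" using integral_curve_exists[OF assms(1)] by blast
  have "lie_exp atlas G (t *\<^sub>R X) = \<gamma> t" if "0 < t" for t
    using lie_exp_eq[OF W[OF that] integral_curve_scaleR[OF \<gamma>(1), of t]] \<gamma>(2) by simp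
  then have ev: "\<forall>\<^sub>F t in at_right 0. \<gamma> t = lie_exp atlas G (t *\<^sub>R X)"
    by (auto simp: eventually_at_filter)
  have "isCont \<gamma> 0" using \<gamma>(1) by (simp add: integral_curve_def continuous_on_eq_continuous_at)
  then have "(\<gamma> \<longlongrightarrow> \<one>) (at_right 0)"
    using \<gamma>(2) by (auto simp: isCont_def intro: tendsto_mono[OF at_le])
  then show ?thesis using Lim_transform_eventually[OF _ ev] by blast
qed

text \<open>The map sending \<open>x\<close> to \<open>p \<otimes> inv x\<close> is continuous and
  takes the identity to \<open>p\<close>, so for small positive \<open>t\<close> its value at the
  exponential lies in the open set \<open>E\<close>.\<close>

lemma open_right_translate_back:
  assumes "X \<in> lie_algebra atlas G" and "\<And>t. 0 < t \<Longrightarrow> t *\<^sub>R X \<in> lie_algebra atlas G"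
    and E: "open E" "p \<in> E"
  shows "\<exists>t>0. p \<otimes> inv (lie_exp atlas G (t *\<^sub>R X)) \<in> E"
proof -
  have "continuous_on UNIV (\<lambda>x. p \<otimes> inv x)" by (intro continuous_left_mult continuous_inv)
  then have "isCont (\<lambda>x. p \<otimes> inv x) \<one>" by (simp add: continuous_on_eq_continuous_at)
  then have "((\<lambda>t. p \<otimes> inv (lie_exp atlas G (t *\<^sub>R X))) \<longlongrightarrow> p \<otimes> inv \<one>) (at_right 0)"
    using lie_exp_scaleR_tendsto_one[OF assms(1,2)] by (rule isCont_tendsto_compose)
  then have "\<forall>\<^sub>F t in at_right 0. p \<otimes> inv (lie_exp atlas G (t *\<^sub>R X)) \<in> E"
    using E by (auto dest: topological_tendstoD)
  then have "\<forall>\<^sub>F t in at_right (0::real). 0 < t \<and> p \<otimes> inv (lie_exp atlas G (t *\<^sub>R X)) \<in> E"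
    by (intro eventually_conj) (auto simp: eventually_at_filter)
  then show ?thesis
    using eventually_happens[of _ "at_right (0::real)"] by (auto simp: trivial_limit_at_right_real)
qed

section \<open>Words in exponentials and monotone sets\<close>

lemma foldr_lie_exp_mult:
  "foldr (\<lambda>w x. lie_exp atlas G w \<otimes> x) ws y = foldr (\<lambda>w x. lie_exp atlas G w \<otimes> x) ws \<one> \<otimes> y"
proof (induction ws)
  case (Cons w ws)
  have "foldr (\<lambda>w x. lie_exp atlas G w \<otimes> x) (w # ws) y =
      lie_exp atlas G w \<otimes> (foldr (\<lambda>w x. lie_exp atlas G w \<otimes> x) ws \<one> \<otimes> y)"
    by (simp only: foldr_Cons o_apply Cons)
  then show ?case by (simp only: foldr_Cons o_apply m_assoc[OF in_carrier in_carrier in_carrier])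
qed simp

lemma exp_semigroupI:
  assumes "w \<in> W"
  shows "lie_exp atlas G w \<in> exp_semigroup atlas G W"
proof -
  have "lie_exp atlas G w = foldr (\<lambda>w x. lie_exp atlas G w \<otimes> x) [w] \<one>"
    by simp
  moreover have "[w] \<noteq> []" "set [w] \<subseteq> W" using assms by simp_all
  ultimately show ?thesis unfolding exp_semigroup_def by blast
qed

lemma exp_semigroup_mult:
  assumes "x \<in> exp_semigroup atlas G W" "w \<in> W"
  shows "x \<otimes> lie_exp atlas G w \<in> exp_semigroup atlas G W"
proof -
  obtain ws where ws: "x = foldr (\<lambda>w x. lie_exp atlas G w \<otimes> x) ws \<one>" "set ws \<subseteq> W"
    using assms(1) unfolding exp_semigroup_def by blast
  \<comment> \<open>Folding builds a word from its right end; \<open>foldr_lie_exp_mult\<close> lets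
    the new last letter be taken out as a right factor.\<close>
  have "x \<otimes> lie_exp atlas G w = foldr (\<lambda>w x. lie_exp atlas G w \<otimes> x) (ws @ [w]) \<one>"
    using foldr_lie_exp_mult[of ws "lie_exp atlas G w"] by (simp add: ws(1))
  moreover have "ws @ [w] \<noteq> []" "set (ws @ [w]) \<subseteq> W" using ws(2) assms(2) by simp_all
  ultimately show ?thesis unfolding exp_semigroup_def by blast
qed

lemma precisely_monotone_iff:
  "precisely_monotone atlas G X E \<longleftrightarrow> (\<forall>t>0. \<forall>p\<in>E. p \<otimes> lie_exp atlas G (t *\<^sub>R X) \<in> E)"
  by (auto simp: precisely_monotone_def r_coset_def)

text \<open>Forwards take \<open>t = 1\<close>; backwards \<open>t *\<^sub>R X\<close> is itself an
  element of \<open>W\<close>.\<close>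

lemma precisely_monotone_all_iff:
  assumes W: "{t *\<^sub>R X | t X. 0 < t \<and> X \<in> W} = W"
  shows "(\<forall>X\<in>W. precisely_monotone atlas G X E) \<longleftrightarrow>
    (\<forall>X\<in>W. \<forall>p\<in>E. p \<otimes> lie_exp atlas G X \<in> E)" (is "?M \<longleftrightarrow> ?C")
proof
  assume M: ?M
  show ?C
  proof (intro ballI)
    fix X p assume "X \<in> W" "p \<in> E"
    then have "p \<otimes> lie_exp atlas G (1 *\<^sub>R X) \<in> E"
      using M unfolding precisely_monotone_iff by (metis zero_less_one)
    then show "p \<otimes> lie_exp atlas G X \<in> E" by simp
  qed
next
  assume C: ?C
  have "t *\<^sub>R X \<in> W" if "0 < t" "X \<in> W" for t X using W that by blast
  then show ?M using C unfolding precisely_monotone_iff by blast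
qed

text \<open>Words of length one give the forward direction. Conversely, in the induction on a word
  the first letter is absorbed into the base point, so \<open>p\<close> has to stay arbitrary; the
  empty word is a harmless start.\<close>

lemma cone_property_iff:
  "cone_property G (exp_semigroup atlas G W) E \<longleftrightarrow> (\<forall>X\<in>W. \<forall>p\<in>E. p \<otimes> lie_exp atlas G X \<in> E)"
proof
  assume "cone_property G (exp_semigroup atlas G W) E"
  then show "\<forall>X\<in>W. \<forall>p\<in>E. p \<otimes> lie_exp atlas G X \<in> E"
    using exp_semigroupI[of _ W] unfolding cone_property_def set_mult_def by blast
next
  assume step: "\<forall>X\<in>W. \<forall>p\<in>E. p \<otimes> lie_exp atlas G X \<in> E"
  have "p \<otimes> foldr (\<lambda>w x. lie_exp atlas G w \<otimes> x) ws \<one> \<in> E" if "p \<in> E" "set ws \<subseteq> W" for p ws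
    using that
  proof (induction ws arbitrary: p)
    case (Cons w ws)
    then have "(p \<otimes> lie_exp atlas G w) \<otimes> foldr (\<lambda>w x. lie_exp atlas G w \<otimes> x) ws \<one> \<in> E"
      using step by auto
    then show ?case by (simp add: m_assoc)
  qed simp
  then show "cone_property G (exp_semigroup atlas G W) E"
    by (auto simp: cone_property_def set_mult_def exp_semigroup_def)
qed

end

section \<open>The equivalence and its three consequences\<close>

theorem proposition2p29:
  fixes atlas :: "('g::{t2_space,second_countable_topology} set \<times> ('g \<Rightarrow> 'e::euclidean_space)) set"
    and G :: "'g monoid"
    and V :: "nat \<Rightarrow> 'g vfield set" and s :: nat
    and W :: "'g vfield set"
  assumes "carnot_group atlas G V s"
    and "W \<subseteq> lie_algebra atlas G"
    and "W \<noteq> {}"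
    and "{t *\<^sub>R X | t X. 0 < t \<and> X \<in> W} = W"
  shows "(\<forall>E. cone_property G (exp_semigroup atlas G W) E \<longleftrightarrow>
              (\<forall>X\<in>W. precisely_monotone atlas G X E))
       \<and> (\<forall>X\<in>W. precisely_monotone atlas G X (exp_semigroup atlas G W))
       \<and> (\<forall>(A :: 'i set) (F :: 'i \<Rightarrow> 'g set).
            (\<forall>\<alpha>\<in>A. \<forall>X\<in>W. precisely_monotone atlas G X (F \<alpha>)) \<longrightarrow>
            (\<forall>X\<in>W. precisely_monotone atlas G X (\<Union>\<alpha>\<in>A. F \<alpha>)))
       \<and> (\<forall>E. (\<forall>X\<in>W. precisely_monotone atlas G X E) \<and>
              (open E \<or> \<one>\<^bsub>G\<^esub> \<in> exp_semigroup atlas G W) \<longrightarrow>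
            E = (\<Union>p\<in>E. p <#\<^bsub>G\<^esub> exp_semigroup atlas G W))"
proof -
  interpret carnot_group atlas G V s by fact
  let ?S = "exp_semigroup atlas G W"
  note mono_iff = precisely_monotone_all_iff[OF assms(4)]
  have scale: "t *\<^sub>R X \<in> W" if "0 < t" "X \<in> W" for t X using assms(4) that by blast
  have "E = (\<Union>p\<in>E. p <#\<^bsub>G\<^esub> ?S)"
    if E: "\<forall>X\<in>W. precisely_monotone atlas G X E" "open E \<or> \<one>\<^bsub>G\<^esub> \<in> ?S" for E
  proof
    have "cone_property G ?S E" using E(1) by (simp add: mono_iff cone_property_iff)
    then show "(\<Union>p\<in>E. p <#\<^bsub>G\<^esub> ?S) \<subseteq> E"
      by (auto simp: cone_property_def set_mult_def l_coset_def)
    show "E \<subseteq> (\<Union>p\<in>E. p <#\<^bsub>G\<^esub> ?S)"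
    proof
      fix p assume p: "p \<in> E"
      \<comment> \<open>If the identity lies in the semigroup, take \<open>q = p\<close>. Otherwise
        \<open>E\<close> is open, and for some direction in the nonempty \<open>W\<close> one steps
        back from \<open>p\<close> by a short exponential, staying in \<open>E\<close>; that
        exponential is \<open>x\<close>.\<close>
      have "\<exists>q\<in>E. \<exists>x\<in>?S. p = q \<otimes>\<^bsub>G\<^esub> x"
      proof (cases "\<one>\<^bsub>G\<^esub> \<in> ?S")
        case True
        then show ?thesis using p by (intro bexI[of _ p] bexI[of _ "\<one>\<^bsub>G\<^esub>"]) auto
      next
        case False
        then have "open E" using E(2) by blast
        obtain X where X: "X \<in> W" using assms(3) by blast
        obtain t where t: "0 < t" "p \<otimes>\<^bsub>G\<^esub> inv\<^bsub>G\<^esub> (lie_exp atlas G (t *\<^sub>R X)) \<in> E"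
          using open_right_translate_back[OF _ _ \<open>open E\<close> p, of X] X scale assms(2) by blast
        moreover have "lie_exp atlas G (t *\<^sub>R X) \<in> ?S" using t(1) X by (intro exp_semigroupI scale)
        ultimately show ?thesis by (intro bexI[of _ "lie_exp atlas G (t *\<^sub>R X)"]
            bexI[of _ "p \<otimes>\<^bsub>G\<^esub> inv\<^bsub>G\<^esub> (lie_exp atlas G (t *\<^sub>R X))"]) (simp_all add: m_assoc)
      qed
      then show "p \<in> (\<Union>p\<in>E. p <#\<^bsub>G\<^esub> ?S)" by (auto simp: l_coset_def)
    qed
  qed
  moreover have "\<forall>X\<in>W. precisely_monotone atlas G X ?S"
    unfolding mono_iff using exp_semigroup_mult[of _ W] by blast
  \<comment> \<open>Monotonicity is a condition on each point of the set, so it holds in the union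
    as soon as it holds in the member containing the point.\<close>
  moreover have "\<forall>(A :: 'i set) (F :: 'i \<Rightarrow> 'g set).
      (\<forall>\<alpha>\<in>A. \<forall>X\<in>W. precisely_monotone atlas G X (F \<alpha>)) \<longrightarrow>
      (\<forall>X\<in>W. precisely_monotone atlas G X (\<Union>\<alpha>\<in>A. F \<alpha>))"
    unfolding precisely_monotone_iff by blast
  ultimately show ?thesis
    unfolding mono_iff cone_property_iff by blast
qed

end
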